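(* Let $k>0$ and let $A\in\mathbb{C}^{m\times n}$ be a $k$-Hadamard matrix. Then for any non-zero $v\in\mathbb{C}^n$, \[ |\operatorname{supp}(v)|\cdot|\operatorname{supp}(Av)|\ \ge\ k . \]
   Context: A matrix $A\in\mathbb{C}^{m\times n}$ is called $k$-Hadamard (for a real number $k>0$) if every entry of $A$ has absolute value at most $1$ and $\|A^*Av\|_\infty\ge k\|v\|_\infty$ for all $v\in\mathbb{C}^n$, where $A^*$ is the conjugate transpose and $\|u\|_\infty=\max_i|u_i|$. For a vector $v$, $\operatorname{supp}(v)$ is the set of coordinates $i$ with $v_i\ne 0$. *)

theory Defs
  imports "HOL-Analysis.Analysis"
begin

definition conj_transpose :: "complex ^ 'n ^ 'm \<Rightarrow> complex ^ 'm ^ 'n" where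
  "conj_transpose A = (\<chi> i j. cnj (A $ j $ i))"

text \<open>The library's \<open>infnorm\<close> is not suitable here: on complex vectors it takes the maximum over
  the real and imaginary parts of the entries, not over their moduli.\<close>

definition sup_norm :: "complex ^ 'n \<Rightarrow> real" where
  "sup_norm v = Max (range (\<lambda>i. norm (v $ i)))"

definition hadamard :: "real \<Rightarrow> complex ^ 'n ^ 'm \<Rightarrow> bool" where
  "hadamard k A \<longleftrightarrow>
     (\<forall>i j. norm (A $ i $ j) \<le> 1) \<and>
     (\<forall>v. sup_norm ((conj_transpose A ** A) *v v) \<ge> k * sup_norm v)"

definition supp :: "complex ^ 'n \<Rightarrow> 'n set" where
  "supp v = {i. v $ i \<noteq> 0}"

end

theory Submission
  imports Defs
begin

text \<open>
  A matrix whose entries have modulus at most \<open>1\<close> enlarges the sup norm of a vector by at most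
  the size of the support of that vector, since each coordinate of the product is a sum with one
  term of modulus at most the sup norm per support element (\<open>sup_norm_mult_le_card_supp\<close>).
  Both \<open>A\<close> and its conjugate transpose are such matrices. Applying the bound to \<open>A\<close> and \<open>v\<close>, then
  to the conjugate transpose and \<open>A *v v\<close>, shows that the Gram matrix enlarges the sup norm of \<open>v\<close>
  by at most the product of the two support sizes. The Hadamard condition says that it enlarges it
  by at least \<open>k\<close>, and the nonzero sup norm of \<open>v\<close> cancels.
\<close>

lemma norm_nth_le_sup_norm: "norm (v $ i) \<le> sup_norm v"
  unfolding sup_norm_def by (rule Max_ge) auto

lemma sup_norm_le_iff: "sup_norm v \<le> c \<longleftrightarrow> (\<forall>i. norm (v $ i) \<le> c)"
  unfolding sup_norm_def by (subst Max_le_iff) auto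

lemma sup_norm_pos:
  assumes "v \<noteq> 0"
  shows "0 < sup_norm v"
proof -
  obtain i where "v $ i \<noteq> 0"
    using assms by (auto simp: vec_eq_iff)
  then have "0 < norm (v $ i)" by simp
  also have "\<dots> \<le> sup_norm v" by (rule norm_nth_le_sup_norm)
  finally show ?thesis .
qed

text \<open>
  This is the chain of bounds from the sup norm of \<open>B *v u\<close> to the \<open>1\<close>-norm of \<open>u\<close> (bounded
  entries) and from there to the support size times the sup norm of \<open>u\<close>.
\<close>

lemma sup_norm_mult_le_card_supp:
  fixes B :: "complex ^ 'n ^ 'm"
  assumes "\<And>i j. norm (B $ i $ j) \<le> 1"
  shows "sup_norm (B *v u) \<le> real (card (supp u)) * sup_norm u"
  unfolding sup_norm_le_iff
proof
  fix i
  have "(B *v u) $ i = (\<Sum>j\<in>supp u. B $ i $ j * u $ j)"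
    unfolding matrix_vector_mult_def vec_lambda_beta
    by (rule sum.mono_neutral_right) (auto simp: supp_def)
  moreover have "norm (B $ i $ j * u $ j) \<le> sup_norm u" for j
    using mult_mono[OF assms[of i j] norm_nth_le_sup_norm[of u j]] by (simp add: norm_mult)
  ultimately show "norm ((B *v u) $ i) \<le> real (card (supp u)) * sup_norm u"
    by (simp add: sum_norm_bound)
qed

theorem theorem3p2:
  fixes k :: real and A :: "complex ^ 'n ^ 'm" and v :: "complex ^ 'n"
  assumes "k > 0"
    and "hadamard k A"
    and "v \<noteq> 0"
  shows "real (card (supp v)) * real (card (supp (A *v v))) \<ge> k"
proof -
  have entries: "norm (A $ i $ j) \<le> 1" for i j
    using assms(2) by (simp add: hadamard_def)
  then have entries_adj: "norm (conj_transpose A $ i $ j) \<le> 1" for i j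
    by (simp add: conj_transpose_def)
  have "k * sup_norm v \<le> sup_norm (conj_transpose A *v (A *v v))"
    using assms(2) by (simp add: hadamard_def matrix_vector_mul_assoc)
  also have "\<dots> \<le> real (card (supp (A *v v))) * sup_norm (A *v v)"
    by (rule sup_norm_mult_le_card_supp[OF entries_adj])
  also have "\<dots> \<le> real (card (supp (A *v v))) * (real (card (supp v)) * sup_norm v)"
    by (rule mult_left_mono[OF sup_norm_mult_le_card_supp[OF entries]]) simp
  finally have "k * sup_norm v \<le> (real (card (supp v)) * real (card (supp (A *v v)))) * sup_norm v"
    by (simp add: mult_ac)
  then show ?thesis
    using sup_norm_pos[OF assms(3)] by (rule mult_right_le_imp_le)
qed

end
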